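(* Consider the data market described in the context with $n$ buyers and parameters $\alpha = 0.733(n-1)$ and $\beta = 0.860(n-1)$. In the limit $n\to\infty$, i.e. for all sufficiently large $n$, the sellers' linear pricing game has no $1.363$-approximate Nash equilibrium: there is no pair of prices $(p,q)\in\mathbb{R}_{\ge 0}^2$ such that both $r_1(p',q)\le 1.363\, r_1(p,q)$ for all $p'\ge 0$ and $r_2(p,q')\le 1.363\, r_2(p,q)$ for all $q'\ge 0$.
   Context: Market. Let $n\ge 2$ be an integer and $1<\alpha\le\beta$ reals. There are two sellers, each owning one divisible, non-rivalrous dataset (every buyer may purchase any fraction in $[0,1]$ of each dataset, regardless of what the others buy). There are $n$ buyers: $n-1$ "poor" buyers, each with budget $1$, value $\alpha$ for dataset 1 and value $1$ for dataset 2; and one "rich" buyer with budget $\beta$, value $\beta$ for dataset 1 and value $0$ for dataset 2. Pricing game. Seller 1 posts a linear price $p\ge 0$ and seller 2 a linear price $q\ge 0$, so fractions $x_1,x_2$ cost $p x_1+q x_2$. A buyer with budget $b$ and values $\tau_1,\tau_2$ buys $(x_1,x_2)\in[0,1]^2$ maximizing $\tau_1x_1+\tau_2x_2$ subject to $p x_1+q x_2\le b$, with $x_j=0$ whenever $\tau_j=0$. If there are several maximizers, the buyer selects one according to an arbitrary fixed tie-breaking rule known to the sellers. $r_1(p,q)$ and $r_2(p,q)$ denote the total payments received by sellers 1 and 2 from all buyers. $(p,q)$ is a $c$-approximate Nash equilibrium if no seller can increase her revenue by more than a factor $c$ by unilaterally changing her price. *)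

theory Defs
  imports Complex_Main
begin

record buyer =
  budget :: real
  val1 :: real
  val2 :: real

definition poor_buyer :: "real \<Rightarrow> buyer" where
  "poor_buyer \<alpha> = \<lparr>budget = 1, val1 = \<alpha>, val2 = 1\<rparr>"

definition rich_buyer :: "real \<Rightarrow> buyer" where
  "rich_buyer \<beta> = \<lparr>budget = \<beta>, val1 = \<beta>, val2 = 0\<rparr>"

text \<open>The \<open>n\<close> buyers are indexed by \<open>{..<n}\<close>; the buyer with index \<open>n - 1\<close> is the rich one.\<close>

definition market :: "nat \<Rightarrow> real \<Rightarrow> real \<Rightarrow> nat \<Rightarrow> buyer" where
  "market n \<alpha> \<beta> i = (if i < n - 1 then poor_buyer \<alpha> else rich_buyer \<beta>)"

definition utility :: "buyer \<Rightarrow> real \<times> real \<Rightarrow> real" where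
  "utility b x = val1 b * fst x + val2 b * snd x"

definition feasible :: "buyer \<Rightarrow> real \<Rightarrow> real \<Rightarrow> real \<times> real \<Rightarrow> bool" where
  "feasible b p q x \<longleftrightarrow>
     fst x \<in> {0..1} \<and> snd x \<in> {0..1} \<and>
     p * fst x + q * snd x \<le> budget b \<and>
     (val1 b = 0 \<longrightarrow> fst x = 0) \<and> (val2 b = 0 \<longrightarrow> snd x = 0)"

definition demand :: "buyer \<Rightarrow> real \<Rightarrow> real \<Rightarrow> (real \<times> real) set" where
  "demand b p q = {x. is_arg_max (utility b) (feasible b p q) x}"

text \<open>
  A tie-breaking rule is represented by the purchases \<open>D i p q\<close> it induces: for every buyer
  \<open>i\<close> and every pair of prices, one element of the demand set. It may treat identical
  buyers differently and may depend on the prices in an arbitrary way.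
\<close>

definition tie_breaking_rule ::
    "nat \<Rightarrow> (nat \<Rightarrow> buyer) \<Rightarrow> (nat \<Rightarrow> real \<Rightarrow> real \<Rightarrow> real \<times> real) \<Rightarrow> bool" where
  "tie_breaking_rule n B D \<longleftrightarrow>
     (\<forall>i<n. \<forall>p\<ge>0. \<forall>q\<ge>0. D i p q \<in> demand (B i) p q)"

definition revenue1 ::
    "nat \<Rightarrow> (nat \<Rightarrow> real \<Rightarrow> real \<Rightarrow> real \<times> real) \<Rightarrow> real \<Rightarrow> real \<Rightarrow> real" where
  "revenue1 n D p q = (\<Sum>i<n. p * fst (D i p q))"

definition revenue2 ::
    "nat \<Rightarrow> (nat \<Rightarrow> real \<Rightarrow> real \<Rightarrow> real \<times> real) \<Rightarrow> real \<Rightarrow> real \<Rightarrow> real" where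
  "revenue2 n D p q = (\<Sum>i<n. q * snd (D i p q))"

definition approx_nash_equilibrium ::
    "real \<Rightarrow> (real \<Rightarrow> real \<Rightarrow> real) \<Rightarrow> (real \<Rightarrow> real \<Rightarrow> real) \<Rightarrow> real \<Rightarrow> real \<Rightarrow> bool" where
  "approx_nash_equilibrium c r1 r2 p q \<longleftrightarrow>
     p \<ge> 0 \<and> q \<ge> 0 \<and>
     (\<forall>p'\<ge>0. r1 p' q \<le> c * r1 p q) \<and>
     (\<forall>q'\<ge>0. r2 p q' \<le> c * r2 p q)"

end

theory Submission
  imports Defs
begin

text \<open>
  Put \<open>m = n - 1\<close>. Whatever \<open>q\<close> is, seller 1 earns at least about \<open>1.3635 m\<close> either from the
  price \<open>\<beta>\<close> (the rich buyer pays \<open>0.86 m\<close> and each poor one what is left after paying \<open>q\<close>) or,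
  if \<open>q\<close> exceeds about \<open>0.496\<close>, from a price slightly below \<open>\<alpha> q\<close> (dataset 1 then takes the whole
  budget of every poor buyer). So in a \<open>1.363\<close>-equilibrium \<open>r\<^sub>1\<close> must exceed \<open>m + 1\<close>.
  If \<open>p < \<alpha> q\<close>, then \<open>p \<ge> 1\<close> would leave seller 2 with nothing, and \<open>p < 1\<close> gives \<open>r\<^sub>1 \<le> m + 1\<close>.
  If \<open>\<alpha> q \<le> p < \<alpha>\<close>, seller 2 can move just below \<open>p / \<alpha>\<close>, so she already earns about
  \<open>m p / (1.363 \<alpha>)\<close>, which is at least \<open>p\<close> because \<open>0.733 \<cdot> 1.363 < 1\<close>; poor budgets then give
  \<open>r\<^sub>1 \<le> p + m - r\<^sub>2 \<le> m\<close>.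
  If \<open>p \<ge> \<alpha>\<close>, she earns about \<open>m / 1.363\<close>, so \<open>q\<close> is at least about \<open>1 / 1.363\<close>; then \<open>r\<^sub>1\<close> is at most
  about \<open>1.1265 m\<close> and undercutting \<open>\<alpha> q\<close> yields about \<open>1.5376 m\<close>, which is more than \<open>1.363\<close> times as much.
\<close>

section \<open>Demand of a single buyer\<close>

lemma demand_feasible: "x \<in> demand b p q \<Longrightarrow> feasible b p q x"
  by (simp add: demand_def is_arg_max_def)

lemma demand_optimal: "x \<in> demand b p q \<Longrightarrow> feasible b p q y \<Longrightarrow> utility b y \<le> utility b x"
  by (metis demand_def is_arg_max_linorder mem_Collect_eq)

lemma poor_feasible_iff:
  "\<alpha> > 0 \<Longrightarrow> feasible (poor_buyer \<alpha>) p q x \<longleftrightarrow>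
     fst x \<in> {0..1} \<and> snd x \<in> {0..1} \<and> p * fst x + q * snd x \<le> 1"
  by (simp add: feasible_def poor_buyer_def)

lemma utility_poor: "utility (poor_buyer \<alpha>) x = \<alpha> * fst x + snd x"
  by (simp add: utility_def poor_buyer_def)

lemma rich_feasible_iff:
  "\<beta> > 0 \<Longrightarrow> feasible (rich_buyer \<beta>) p q x \<longleftrightarrow>
     fst x \<in> {0..1} \<and> snd x = 0 \<and> p * fst x \<le> \<beta>"
  by (auto simp: feasible_def rich_buyer_def)

lemma rich_demand_affordable:
  assumes "\<beta> > 0" "p \<le> \<beta>" "x \<in> demand (rich_buyer \<beta>) p q"
  shows "fst x = 1"
proof -
  have "feasible (rich_buyer \<beta>) p q (1, 0)" using assms by (simp add: rich_feasible_iff)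
  with assms(3) have "utility (rich_buyer \<beta>) (1, 0) \<le> utility (rich_buyer \<beta>) x"
    by (rule demand_optimal)
  moreover have "fst x \<le> 1"
    using demand_feasible[OF assms(3)] assms(1) by (simp add: rich_feasible_iff)
  ultimately show ?thesis using assms(1) by (simp add: utility_def rich_buyer_def)
qed

text \<open>Per unit of money dataset 1 yields \<open>\<alpha> / p\<close>, more than the
  \<open>1 / q\<close> of dataset 2, and \<open>1 \<le> p\<close> lets it absorb the whole
  budget.\<close>

lemma poor_demand_prefers_1:
  assumes "1 \<le> p" "p < \<alpha> * q" "\<alpha> > 0" "x \<in> demand (poor_buyer \<alpha>) p q"
  shows "p * fst x = 1" "snd x = 0"
proof -
  have feas: "fst x \<in> {0..1}" "snd x \<in> {0..1}" "p * fst x + q * snd x \<le> 1"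
    using demand_feasible[OF assms(4)] assms(3) by (simp_all add: poor_feasible_iff)
  have "feasible (poor_buyer \<alpha>) p q (1 / p, 0)" using assms by (simp add: poor_feasible_iff)
  from demand_optimal[OF assms(4) this] have "\<alpha> / p \<le> \<alpha> * fst x + snd x"
    by (simp add: utility_poor)
  then have opt: "\<alpha> \<le> \<alpha> * (p * fst x) + p * snd x" using assms(1) by (simp add: field_simps)
  \<comment> \<open>The budget constraint scaled by \<open>\<alpha>\<close>; combined with
    \<open>opt\<close> it cancels the terms in \<open>fst x\<close>.\<close>
  have "\<alpha> * (p * fst x + q * snd x) \<le> \<alpha> * 1"
    using feas(3) assms(3) by (intro mult_left_mono) auto
  with opt have "(\<alpha> * q - p) * snd x \<le> 0" by (simp add: algebra_simps)
  with assms(2) feas(2) show snd0: "snd x = 0" by (simp add: mult_le_0_iff)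
  with opt assms(3) have "1 \<le> p * fst x" by simp
  with feas(3) snd0 show "p * fst x = 1" by simp
qed

text \<open>The rival bundle has all of dataset 2, so an optimal one cannot hold less of dataset 1.
  The bound thus holds for either order of the value-price ratios and for any tie-breaking.\<close>

lemma poor_demand_residual:
  assumes "1 \<le> p" "0 \<le> q" "q \<le> 1" "\<alpha> > 0" "x \<in> demand (poor_buyer \<alpha>) p q"
  shows "1 - q \<le> p * fst x"
proof -
  have "snd x \<le> 1"
    using demand_feasible[OF assms(5)] assms(4) by (simp add: poor_feasible_iff)
  have "feasible (poor_buyer \<alpha>) p q ((1 - q) / p, 1)"
    using assms by (simp add: poor_feasible_iff)
  from demand_optimal[OF assms(5) this] \<open>snd x \<le> 1\<close> have "\<alpha> * ((1 - q) / p) \<le> \<alpha> * fst x"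
    by (simp add: utility_poor)
  then have "(1 - q) / p \<le> fst x" using assms(4) by (simp only: mult_le_cancel_left_pos)
  then show ?thesis using assms(1) by (simp add: field_simps)
qed

lemma poor_demand_prefers_2:
  assumes "0 \<le> q" "q \<le> 1" "\<alpha> * q < p" "\<alpha> > 0" "x \<in> demand (poor_buyer \<alpha>) p q"
  shows "snd x = 1"
proof -
  have p: "p > 0" using assms by (smt (verit) mult_nonneg_nonneg)
  have feas: "fst x \<in> {0..1}" "snd x \<in> {0..1}" "p * fst x + q * snd x \<le> 1"
    using demand_feasible[OF assms(5)] assms(4) by (simp_all add: poor_feasible_iff)
  show ?thesis
  \<comment> \<open>If both datasets are affordable, the rival bundle is \<open>(1, 1)\<close>;
    otherwise it is all of dataset 2 plus what the remaining budget buys.\<close>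
  proof (cases "p \<le> 1 - q")
    case True
    then have "feasible (poor_buyer \<alpha>) p q (1, 1)" using assms by (simp add: poor_feasible_iff)
    from demand_optimal[OF assms(5) this] have "\<alpha> * (1 - fst x) + (1 - snd x) \<le> 0"
      by (simp add: utility_poor algebra_simps)
    moreover have "0 \<le> \<alpha> * (1 - fst x)" using feas assms(4) by simp
    ultimately show ?thesis using feas(2) by simp
  next
    case False
    then have "feasible (poor_buyer \<alpha>) p q ((1 - q) / p, 1)"
      using assms p by (simp add: poor_feasible_iff)
    from demand_optimal[OF assms(5) this] have "\<alpha> * (1 - q) / p + 1 \<le> \<alpha> * fst x + snd x"
      by (simp add: utility_poor)
    then have "\<alpha> * (1 - q) + p \<le> \<alpha> * (p * fst x) + p * snd x"
      using p by (simp add: field_simps)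
    moreover have "\<alpha> * (p * fst x + q * snd x) \<le> \<alpha> * 1"
      using feas(3) assms(4) by (intro mult_left_mono) auto
    ultimately have "(p - \<alpha> * q) * (1 - snd x) \<le> 0" by (simp add: algebra_simps)
    with assms(3) feas(2) show ?thesis by (simp add: mult_le_0_iff)
  qed
qed

section \<open>Revenues in the whole market\<close>

locale data_market =
  fixes m :: nat and \<alpha> \<beta> :: real and D :: "nat \<Rightarrow> real \<Rightarrow> real \<Rightarrow> real \<times> real"
  assumes pos: "\<alpha> > 0" "\<beta> > 0"
    and rule: "tie_breaking_rule (Suc m) (market (Suc m) \<alpha> \<beta>) D"
begin

abbreviation "r1 \<equiv> revenue1 (Suc m) D"
abbreviation "r2 \<equiv> revenue2 (Suc m) D"

lemma poor_demand: "i < m \<Longrightarrow> 0 \<le> p \<Longrightarrow> 0 \<le> q \<Longrightarrow> D i p q \<in> demand (poor_buyer \<alpha>) p q"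
  using rule[unfolded tie_breaking_rule_def, rule_format, of i p q] by (simp add: market_def)

lemma rich_demand: "0 \<le> p \<Longrightarrow> 0 \<le> q \<Longrightarrow> D m p q \<in> demand (rich_buyer \<beta>) p q"
  using rule[unfolded tie_breaking_rule_def, rule_format, of m p q] by (simp add: market_def)

lemma poor_feasible:
  assumes "i < m" "0 \<le> p" "0 \<le> q"
  shows "fst (D i p q) \<in> {0..1}" "snd (D i p q) \<in> {0..1}"
    "p * fst (D i p q) + q * snd (D i p q) \<le> 1"
  using demand_feasible[OF poor_demand[OF assms]] pos by (simp_all add: poor_feasible_iff)

lemma rich_feasible:
  assumes "0 \<le> p" "0 \<le> q"
  shows "fst (D m p q) \<in> {0..1}" "snd (D m p q) = 0" "p * fst (D m p q) \<le> \<beta>"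
  using demand_feasible[OF rich_demand[OF assms]] pos by (simp_all add: rich_feasible_iff)

lemma r1_eq: "r1 p q = (\<Sum>i<m. p * fst (D i p q)) + p * fst (D m p q)"
  by (simp add: revenue1_def)

lemma r2_eq: "0 \<le> p \<Longrightarrow> 0 \<le> q \<Longrightarrow> r2 p q = (\<Sum>i<m. q * snd (D i p q))"
  by (simp add: revenue2_def rich_feasible)

lemma rich_payment_le:
  assumes "0 \<le> p" "0 \<le> q"
  shows "p * fst (D m p q) \<le> min p \<beta>"
  using rich_feasible[OF assms] assms by (simp add: mult_left_le)

lemma r1_le_price:
  assumes "0 \<le> p" "0 \<le> q"
  shows "r1 p q \<le> real (Suc m) * p"
proof -
  have "(\<Sum>i<m. p * fst (D i p q)) \<le> (\<Sum>i<m. p)"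
    using poor_feasible assms by (intro sum_mono) (auto intro!: mult_left_le)
  then show ?thesis using rich_payment_le[OF assms] by (simp add: r1_eq algebra_simps)
qed

text \<open>The poor buyers pay at most \<open>m\<close> to both sellers together, and the rich
  buyer pays only seller 1.\<close>

lemma r1_le_budget:
  assumes "0 \<le> p" "0 \<le> q"
  shows "r1 p q \<le> min p \<beta> + real m - r2 p q"
proof -
  have "(\<Sum>i<m. p * fst (D i p q) + q * snd (D i p q)) \<le> (\<Sum>i<m. 1)"
    using poor_feasible assms by (intro sum_mono) auto
  then show ?thesis using rich_payment_le[OF assms]
    unfolding r1_eq r2_eq[OF assms] sum.distrib by simp linarith
qed

lemma r2_nonneg: "0 \<le> p \<Longrightarrow> 0 \<le> q \<Longrightarrow> 0 \<le> r2 p q"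
  using poor_feasible by (auto simp: r2_eq intro!: sum_nonneg)

lemma r2_le_price:
  assumes "0 \<le> p" "0 \<le> q"
  shows "r2 p q \<le> real m * q"
proof -
  have "(\<Sum>i<m. q * snd (D i p q)) \<le> (\<Sum>i<m. q)"
    using poor_feasible assms by (intro sum_mono) (auto intro!: mult_left_le)
  then show ?thesis by (simp add: r2_eq[OF assms])
qed

lemma r1_preferred:
  assumes "1 \<le> p" "p \<le> \<beta>" "p < \<alpha> * q" "0 \<le> q"
  shows "r1 p q = p + real m"
proof -
  have "p * fst (D i p q) = 1" if "i < m" for i
    using poor_demand_prefers_1[OF assms(1,3) pos(1) poor_demand[OF that]] assms by simp
  moreover have "fst (D m p q) = 1"
    using rich_demand_affordable[OF pos(2) assms(2) rich_demand] assms by simp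
  ultimately show ?thesis by (simp add: r1_eq)
qed

lemma r2_not_preferred:
  assumes "1 \<le> p" "p < \<alpha> * q" "0 \<le> q"
  shows "r2 p q = 0"
proof -
  have "snd (D i p q) = 0" if "i < m" for i
    using poor_demand_prefers_1[OF assms(1,2) pos(1) poor_demand[OF that]] assms by simp
  then show ?thesis using assms by (simp add: r2_eq)
qed

lemma r1_residual:
  assumes "1 \<le> p" "p \<le> \<beta>" "0 \<le> q" "q \<le> 1"
  shows "p + real m * (1 - q) \<le> r1 p q"
proof -
  have "(\<Sum>i<m. 1 - q) \<le> (\<Sum>i<m. p * fst (D i p q))"
    using poor_demand_residual[OF assms(1,3,4) pos(1) poor_demand] assms by (intro sum_mono) auto
  moreover have "fst (D m p q) = 1"
    using rich_demand_affordable[OF pos(2) assms(2) rich_demand] assms by simp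
  ultimately show ?thesis by (simp add: r1_eq)
qed

lemma r2_preferred:
  assumes "0 \<le> q" "q \<le> 1" "\<alpha> * q < p"
  shows "r2 p q = real m * q"
proof -
  have "0 \<le> \<alpha> * q" using pos assms by simp
  then have p: "0 \<le> p" using assms by simp
  have "snd (D i p q) = 1" if "i < m" for i
    using poor_demand_prefers_2[OF assms pos(1) poor_demand[OF that]] assms p by simp
  then show ?thesis using assms p by (simp add: r2_eq)
qed

end

section \<open>Excluding every pair of prices\<close>

lemma no_equilibrium:
  assumes m: "m \<ge> 3000"
    and rule: "tie_breaking_rule (Suc m) (market (Suc m) (0.733 * real m) (0.860 * real m)) D"
  shows "\<not> approx_nash_equilibrium 1.363 (revenue1 (Suc m) D) (revenue2 (Suc m) D) p q"
proof
  interpret data_market m "0.733 * real m" "0.860 * real m" D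
    using m rule by unfold_locales auto
  define M where "M = real m"
  have M: "M \<ge> 3000" using m by (simp add: M_def)
  assume "approx_nash_equilibrium 1.363 r1 r2 p q"
  then have p: "0 \<le> p" and q: "0 \<le> q"
    and ne1: "0 \<le> p' \<Longrightarrow> r1 p' q \<le> 1.363 * r1 p q"
    and ne2: "0 \<le> q' \<Longrightarrow> r2 p q' \<le> 1.363 * r2 p q" for p' q'
    by (auto simp: approx_nash_equilibrium_def)
  have "\<exists>p'\<ge>0. 1.3635 * M \<le> r1 p' q"
  proof (cases "q \<le> 0.4961")
    case True
    have "1.3635 * M \<le> 0.860 * M + M * 0.5039" using M by simp
    also have "\<dots> \<le> 0.860 * M + M * (1 - q)"
      using True M by (intro add_left_mono mult_left_mono) auto
    also have "\<dots> \<le> r1 (0.860 * M) q"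
      using r1_residual[of "0.860 * M" q] True q M by (simp add: M_def)
    finally have "1.3635 * M \<le> r1 (0.860 * M) q" .
    then show ?thesis using M by (intro exI[of _ "0.860 * M"]) auto
  next
    case False
    \<comment> \<open>Rounding 0.4961 down to 0.496 makes the undercutting strict, and 0.733 * 0.496
      still exceeds 0.3635.\<close>
    then have "0.733 * M * 0.496 < 0.733 * M * q" using M by (intro mult_strict_left_mono) auto
    then have "r1 (0.733 * M * 0.496) q = 0.733 * M * 0.496 + M"
      using r1_preferred[of "0.733 * M * 0.496" q] q M by (simp add: M_def)
    then show ?thesis using M by (intro exI[of _ "0.733 * M * 0.496"]) auto
  qed
  then have "1.3635 * M \<le> 1.363 * r1 p q" using ne1 order_trans by blast
  \<comment> \<open>The surplus 0.0005 * M / 1.363 exceeds 1 because M \<ge> 3000.\<close>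
  then have r1_large: "M + 1 < r1 p q" using M by (simp add: field_simps)
  show False
  proof (cases "p < 0.733 * M * q")
    case True
    show False
    proof (cases "1 \<le> p")
      case True
      \<comment> \<open>Chosen so that \<open>0.733 * M * q'\<close> is 1/2, below every p \<ge>
        1.\<close>
      define q' where "q' = 1 / (2 * (0.733 * M))"
      have q': "0 < q'" "q' \<le> 1" "0.733 * M * q' < p" using M True by (auto simp: q'_def)
      have "r2 p q = 0"
        using r2_not_preferred[of p q] True \<open>p < 0.733 * M * q\<close> q by (simp add: M_def)
      moreover have "r2 p q' = M * q'" using r2_preferred[of q' p] q' by (simp add: M_def)
      moreover have "0 < M * q'" using M q' by simp
      ultimately show False using ne2[of q'] q' by simp
    next
      case False
      then have "real (Suc m) * p \<le> real (Suc m) * 1" by (intro mult_left_mono) auto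
      with r1_le_price[OF p q] have "r1 p q \<le> real (Suc m) * 1" by (rule order_trans)
      then show False using r1_large by (simp add: M_def)
    qed
  next
    case False
    show False
    proof (cases "p < 0.733 * M")
      case True
      have "p \<le> r2 p q"
      \<comment> \<open>At p = 0 strict undercutting is impossible, but the bound is
        trivial.\<close>
      proof (cases "p = 0")
        case True
        then show ?thesis using r2_nonneg p q by simp
      next
        case False
        \<comment> \<open>The factor 0.9995 lies between 0.733 * 1.363 = 0.999079 and 1.\<close>
        define q' where "q' = 0.9995 * p / (0.733 * M)"
        have q': "0 \<le> q'" "q' \<le> 1" using True M p by (auto simp: q'_def)
        have eq: "0.733 * (M * q') = 0.9995 * p" using M by (simp add: q'_def)
        then have "0.733 * M * q' < p" using False p by simp
        then have "r2 p q' = M * q'"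
          using r2_preferred[of q' p] q' by (simp add: M_def)
        with ne2[OF q'(1)] have "0.733 * (M * q') \<le> 0.733 * (1.363 * r2 p q)" by simp
        with eq show ?thesis using r2_nonneg[OF p q] by simp
      qed
      then show False using r1_le_budget[OF p q] r1_large by (simp add: M_def)
    next
      case False
      \<comment> \<open>Just below 1, so that \<open>\<alpha> * 0.9999 < p\<close> even at p =
        \<alpha>; 0.9999 / 1.363 still exceeds 0.7335.\<close>
      then have "r2 p 0.9999 = M * 0.9999"
        using r2_preferred[of "0.9999" p] M by (simp add: M_def)
      then have r2_large: "0.7335 * M \<le> r2 p q" using ne2[of "0.9999"] M by simp
      then have "M * 0.7335 \<le> M * q" using r2_le_price[OF p q] by (simp add: M_def)
      then have "0.7335 \<le> q" using M by simp
      then have "0.733 * M * 0.7334 < 0.733 * M * q" using M by (intro mult_strict_left_mono) auto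
      then have "r1 (0.733 * M * 0.7334) q = 0.733 * M * 0.7334 + M"
        using r1_preferred[of "0.733 * M * 0.7334" q] q M by (simp add: M_def)
      moreover have "r1 p q \<le> 0.860 * M + M - 0.7335 * M"
        using r1_le_budget[OF p q] r2_large by (simp add: M_def)
      ultimately show False using ne1[of "0.733 * M * 0.7334"] M by simp
    qed
  qed
qed

theorem theorem1:
  "\<forall>\<^sub>F n :: nat in sequentially.
     \<forall>D. tie_breaking_rule n (market n (0.733 * (real n - 1)) (0.860 * (real n - 1))) D \<longrightarrow>
       \<not> (\<exists>p q. approx_nash_equilibrium 1.363 (revenue1 n D) (revenue2 n D) p q)"
proof (rule eventually_sequentiallyI)
  fix n :: nat
  assume n: "3001 \<le> n"
  define m where "m = n - 1"
  have "n = Suc m" "m \<ge> 3000" using n by (auto simp: m_def)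
  then show "\<forall>D. tie_breaking_rule n (market n (0.733 * (real n - 1)) (0.860 * (real n - 1))) D \<longrightarrow>
       \<not> (\<exists>p q. approx_nash_equilibrium 1.363 (revenue1 n D) (revenue2 n D) p q)"
    using no_equilibrium[of m] by simp
qed

end
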